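(* Let $R$ be a unital ring, let $n\geq 2$ be an integer, let $f(x,y,z)=[x,[z,y]]$, and let $A=(a_{ij})\in\mathbb{M}_n(R)$ be such that for each $j\in\{0,1,\dots,n-1\}$ we have $\sum_{i=1}^{n-j}a_{i,i+j}=0$. Then $A=f(D,X,Y)$ for some $D\in\mathbb{M}_n(R)$, where $X=\sum_{i=1}^{n-1}E_{i+1,i}$ and $Y=\sum_{i=1}^{n}(i-1)E_{ii}$.
   Context: Rings are associative and not necessarily commutative. $\mathbb{M}_n(R)$ is the ring of $n\times n$ matrices over $R$, $E_{ij}\in\mathbb{M}_n(R)$ are the matrix units (entry $1$ in position $(i,j)$ and $0$ elsewhere), and $[r,p]=rp-pr$ denotes the commutator. *)

theory Defs
  imports "Jordan_Normal_Form.Matrix"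
begin

(* Matrices are 0-indexed here, so every index i of the 1-indexed convention becomes i - 1. *)

definition mat_unit :: "nat \<Rightarrow> nat \<Rightarrow> nat \<Rightarrow> 'a :: {zero, one} mat" where
  "mat_unit n i j = mat n n (\<lambda>(k, l). if k = i \<and> l = j then 1 else 0)"

(* The type 'a mat contains matrices of all dimensions, so it has no neutral element of addition
   and the overloaded sum operator is not available; compare finsum_vec for vectors. *)
definition finsum_mat :: "nat \<Rightarrow> ('c \<Rightarrow> 'a :: monoid_add mat) \<Rightarrow> 'c set \<Rightarrow> 'a mat" where
  "finsum_mat n = finprod (monoid_mat TYPE('a) n n)"

(* The image of a natural number in a unital ring. This is of_nat, except that of_nat demands
   0 \<noteq> 1, which would rule out the zero ring. *)
definition nat_elem :: "nat \<Rightarrow> 'a :: {comm_monoid_add, one}" where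
  "nat_elem k = (\<Sum>i<k. 1)"

definition commutator :: "'a :: {times, minus} \<Rightarrow> 'a \<Rightarrow> 'a" where
  "commutator r p = r * p - p * r"

definition f_poly :: "'a :: {times, minus} \<Rightarrow> 'a \<Rightarrow> 'a \<Rightarrow> 'a" where
  "f_poly x y z = commutator x (commutator z y)"

definition X_mat :: "nat \<Rightarrow> 'a :: {ring, monoid_mult} mat" where
  "X_mat n = finsum_mat n (\<lambda>i. mat_unit n (i + 1) i) {..<n - 1}"

definition Y_mat :: "nat \<Rightarrow> 'a :: {ring, monoid_mult} mat" where
  "Y_mat n = finsum_mat n (\<lambda>i. nat_elem i \<cdot>\<^sub>m mat_unit n i i) {..<n}"

end

theory Submission
  imports Defs
begin

text \<open>
  The inner commutator \<open>Y X - X Y\<close> is \<open>X\<close> itself, because \<open>X\<close> lives on the subdiagonal and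
  consecutive diagonal entries of \<open>Y\<close> differ by \<open>1\<close> (\<open>commutator_Y_X\<close>). So the claim is that \<open>A = D X - X D\<close> is solvable for \<open>D\<close>.

  Right multiplication by \<open>X\<close> shifts the columns and left multiplication shifts the rows, so the
  equation reads \<open>A(k, l) = D(k, l + 1) - D(k - 1, l)\<close>, where entries of \<open>D\<close> outside the matrix
  count as \<open>0\<close>. This is a telescoping recurrence along each diagonal. Starting with zeros in
  column \<open>0\<close>, it determines \<open>D(k, l + 1)\<close> as the sum of the entries of \<open>A\<close> on the diagonal of
  \<open>(k, l)\<close> up to that position. Only the last column \<open>l = n - 1\<close> is left, where
  \<open>D(k, n)\<close> must be \<open>0\<close>: that entry is a complete diagonal sum of \<open>A\<close>, on or above the main
  diagonal, and these vanish by hypothesis (\<open>commutator_X_solvable\<close>).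
\<close>

lemma finsum_mat_eq_mat_sum:
  fixes F :: "'c \<Rightarrow> 'a :: ring mat"
  assumes "finite S" and "\<And>s. s \<in> S \<Longrightarrow> F s \<in> carrier_mat n n"
  shows "finsum_mat n F S = mat n n (\<lambda>(i, j). \<Sum>s\<in>S. F s $$ (i, j))"
  using assms
proof (induction S rule: finite_induct)
  case empty
  interpret M: comm_monoid "monoid_mat TYPE('a) n n" by (rule comm_monoid_mat)
  have "finsum_mat n F {} = 0\<^sub>m n n"
    unfolding finsum_mat_def M.finprod_empty by (simp add: monoid_mat_def)
  then show ?case
    by (auto intro!: eq_matI)
next
  case (insert s S)
  interpret M: comm_monoid "monoid_mat TYPE('a) n n" by (rule comm_monoid_mat)
  have "finsum_mat n F (insert s S) = F s + finsum_mat n F S"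
    unfolding finsum_mat_def using insert.hyps insert.prems
    by (subst M.finprod_insert) (auto simp: monoid_mat_def)
  moreover have "F s \<in> carrier_mat n n"
    using insert.prems by simp
  ultimately show ?case
    using insert by (intro eq_matI) auto
qed

lemma X_mat_eq: "(X_mat n :: 'a :: {ring, monoid_mult} mat) = mat n n (\<lambda>(i, j). if i = Suc j then 1 else 0)"
proof -
  have "(\<Sum>s<n - 1. (mat_unit n (s + 1) s :: 'a mat) $$ (i, j)) = (if i = Suc j then 1 else 0)"
    if "i < n" "j < n" for i j
  proof -
    have "(\<Sum>s<n - 1. (mat_unit n (s + 1) s :: 'a mat) $$ (i, j))
        = (\<Sum>s<n - 1. if s = j then (if i = Suc j then 1 else 0) else 0)"
      using that by (intro sum.cong) (auto simp: mat_unit_def)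
    also have "\<dots> = (if i = Suc j then 1 else 0)"
      using that by auto
    finally show ?thesis .
  qed
  then show ?thesis
    unfolding X_mat_def
    by (subst finsum_mat_eq_mat_sum) (auto simp: mat_unit_def intro!: eq_matI)
qed

lemma Y_mat_eq: "(Y_mat n :: 'a :: {ring, monoid_mult} mat) = mat n n (\<lambda>(i, j). if i = j then nat_elem i else 0)"
proof -
  have "(\<Sum>s<n. (nat_elem s \<cdot>\<^sub>m mat_unit n s s :: 'a mat) $$ (i, j)) = (if i = j then nat_elem i else 0)"
    if "i < n" "j < n" for i j
  proof -
    have "(\<Sum>s<n. (nat_elem s \<cdot>\<^sub>m mat_unit n s s :: 'a mat) $$ (i, j))
        = (\<Sum>s<n. if s = j then (if i = j then nat_elem i else 0) else 0)"
      using that by (intro sum.cong) (auto simp: mat_unit_def)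
    also have "\<dots> = (if i = j then nat_elem i else 0)"
      using that by auto
    finally show ?thesis .
  qed
  then show ?thesis
    unfolding Y_mat_def
    by (subst finsum_mat_eq_mat_sum) (auto simp: mat_unit_def intro!: eq_matI)
qed

lemma X_mat_carrier: "X_mat n \<in> carrier_mat n n"
  and Y_mat_carrier: "Y_mat n \<in> carrier_mat n n"
  by (simp_all add: X_mat_eq Y_mat_eq)

lemma index_mult_mat_sum:
  assumes "B \<in> carrier_mat m n" "C \<in> carrier_mat n p" "i < m" "j < p"
  shows "(B * C) $$ (i, j) = (\<Sum>k<n. B $$ (i, k) * C $$ (k, j))"
  using assms by (auto simp: scalar_prod_def lessThan_atLeast0 intro!: sum.cong)

lemma index_mult_X_mat:
  fixes B :: "'a :: {ring, monoid_mult} mat"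
  assumes "B \<in> carrier_mat n n" "i < n" "j < n"
  shows "(B * X_mat n) $$ (i, j) = (if Suc j < n then B $$ (i, Suc j) else 0)"
proof -
  have "(B * X_mat n) $$ (i, j) = (\<Sum>k<n. if k = Suc j then B $$ (i, k) else 0)"
    unfolding index_mult_mat_sum[OF assms(1) X_mat_carrier assms(2,3)]
    using assms by (intro sum.cong) (auto simp: X_mat_eq)
  then show ?thesis by simp
qed

lemma index_X_mat_mult:
  fixes B :: "'a :: {ring, monoid_mult} mat"
  assumes "B \<in> carrier_mat n n" "i < n" "j < n"
  shows "(X_mat n * B) $$ (i, j) = (if i = 0 then 0 else B $$ (i - 1, j))"
proof -
  have "(X_mat n * B) $$ (i, j) = (\<Sum>k<n. if k = i - 1 then (if i = 0 then 0 else B $$ (k, j)) else 0)"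
    unfolding index_mult_mat_sum[OF X_mat_carrier assms]
    using assms by (intro sum.cong) (auto simp: X_mat_eq)
  then show ?thesis using assms by auto
qed

text \<open>
  Both products are supported on the subdiagonal, where they have the entries \<open>j + 1\<close> and \<open>j\<close>
  in column \<open>j\<close>.
\<close>

lemma commutator_Y_X: "commutator (Y_mat n) (X_mat n) = (X_mat n :: 'a :: {ring, monoid_mult} mat)"
proof (rule eq_matI)
  fix i j assume "i < dim_row (X_mat n :: 'a mat)" "j < dim_col (X_mat n :: 'a mat)"
  then have ij: "i < n" "j < n" by (simp_all add: X_mat_eq)
  have "commutator (Y_mat n) (X_mat n) $$ (i, j)
      = (Y_mat n * X_mat n) $$ (i, j) - (X_mat n * Y_mat n :: 'a mat) $$ (i, j)"
    using ij by (simp add: commutator_def X_mat_eq Y_mat_eq)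
  also have "\<dots> = (X_mat n :: 'a mat) $$ (i, j)"
    using ij index_mult_X_mat[OF Y_mat_carrier ij, where 'a = 'a]
      index_X_mat_mult[OF Y_mat_carrier ij, where 'a = 'a]
    by (auto simp: X_mat_eq Y_mat_eq nat_elem_def)
  finally show "commutator (Y_mat n) (X_mat n) $$ (i, j) = (X_mat n :: 'a mat) $$ (i, j)" .
qed (simp_all add: commutator_def X_mat_eq Y_mat_eq)

fun diag_partial_sum :: "(nat \<Rightarrow> nat \<Rightarrow> 'a :: comm_monoid_add) \<Rightarrow> nat \<Rightarrow> nat \<Rightarrow> 'a" where
  "diag_partial_sum a 0 l = a 0 l"
| "diag_partial_sum a k 0 = a k 0"
| "diag_partial_sum a (Suc k) (Suc l) = a (Suc k) (Suc l) + diag_partial_sum a k l"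

text \<open>
  On or above the main diagonal a diagonal starts in row \<open>0\<close>, so the recursion reaches its first
  entry without being cut off at column \<open>0\<close>.
\<close>

lemma diag_partial_sum_upper:
  "diag_partial_sum a k (k + j) = (\<Sum>i<Suc k. a i (i + j))"
  by (induction k) (simp_all add: add.commute)

text \<open>
  Entrywise the equation is a recurrence along the diagonals, and the partial diagonal sums of
  \<open>A\<close>, moved one column to the right, solve it. The hypothesis on the full sums makes this
  consistent in the last column, where \<open>D\<close> has no room left.
\<close>

lemma commutator_X_solvable:
  fixes A :: "'a :: {ring, monoid_mult} mat"
  assumes A: "A \<in> carrier_mat n n"
    and diag: "\<And>j. j < n \<Longrightarrow> (\<Sum>i<n - j. A $$ (i, i + j)) = 0"
  shows "\<exists>D \<in> carrier_mat n n. A = commutator D (X_mat n)"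
proof
  let ?S = "diag_partial_sum (\<lambda>i j. A $$ (i, j))"
  define D where "D = mat n n (\<lambda>(k, l). if l = 0 then 0 else ?S k (l - 1))"
  show D: "D \<in> carrier_mat n n" by (simp add: D_def)
  \<comment> \<open>The position \<open>(k, n - 1)\<close> is the end of its diagonal, which has offset \<open>n - 1 - k\<close>.\<close>
  have last_col: "?S k (n - 1) = 0" if "k < n" for k
    using diag_partial_sum_upper[of "\<lambda>i j. A $$ (i, j)" k "n - 1 - k"] diag[of "n - 1 - k"] that
    by (simp add: Suc_diff_Suc)
  show "A = commutator D (X_mat n)"
  proof (rule eq_matI)
    fix k l assume "k < dim_row (commutator D (X_mat n))" "l < dim_col (commutator D (X_mat n))"
    then have kl: "k < n" "l < n" using D by (simp_all add: commutator_def X_mat_eq)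
    have "commutator D (X_mat n) $$ (k, l) = (D * X_mat n) $$ (k, l) - (X_mat n * D) $$ (k, l)"
      using kl D by (simp add: commutator_def X_mat_eq)
    also have "(D * X_mat n) $$ (k, l) = ?S k l"
    proof (cases "Suc l < n")
      case True
      then show ?thesis
        using kl index_mult_X_mat[OF D kl] by (simp add: D_def)
    next
      case False
      then have "l = n - 1" using kl by simp
      then show ?thesis
        using kl index_mult_X_mat[OF D kl] last_col by simp
    qed
    also have "(X_mat n * D) $$ (k, l) = (if k = 0 \<or> l = 0 then 0 else ?S (k - 1) (l - 1))"
      using kl index_X_mat_mult[OF D kl] by (simp add: D_def)
    also have "?S k l - \<dots> = A $$ (k, l)"
      by (cases k; cases l) simp_all
    finally show "A $$ (k, l) = commutator D (X_mat n) $$ (k, l)" ..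
  qed (use A D in \<open>simp_all add: commutator_def X_mat_eq\<close>)
qed

theorem theorem17:
  fixes A :: "'a :: {ring, monoid_mult} mat" and n :: nat
  assumes "n \<ge> 2"
    and "A \<in> carrier_mat n n"
    and "\<And>j. j \<in> {0..n - 1} \<Longrightarrow> (\<Sum>i<n - j. A $$ (i, i + j)) = 0"
  shows "\<exists>D \<in> carrier_mat n n. A = f_poly D (X_mat n) (Y_mat n)"
  unfolding f_poly_def commutator_Y_X
  using assms by (intro commutator_X_solvable) auto

end
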